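(* Let $m$ be a positive even integer, let $e=\frac{3^{m}-1}{2}-3^{\frac{m}{2}}-1$, and let $s=\frac{3^m-1}{2}$. Then $\mathcal{C}_{(1,e,s)}$ is an optimal ternary cyclic code with parameters $[3^m-1,\ 3^m-\frac{3m}{2}-2,\ 4]$.
   Context: Let $m$ be a positive integer, $\mathbb{F}_{3^m}$ the finite field with $3^m$ elements, and $\alpha$ a generator of the multiplicative group $\mathbb{F}_{3^m}^*$. For an integer $i$, $m_{\alpha^i}(x)$ denotes the minimal polynomial of $\alpha^i$ over $\mathbb{F}_3$. An $[n,k,d]$ linear code over $\mathbb{F}_3$ is a $k$-dimensional subspace of $\mathbb{F}_3^n$ with minimum Hamming distance $d$. A ternary cyclic code of length $n$ (with $\gcd(n,3)=1$) is identified with an ideal of $\mathbb{F}_3[x]/(x^n-1)$ via $(c_0,\dots,c_{n-1})\mapsto c_0+c_1x+\cdots+c_{n-1}x^{n-1}$; its generator polynomial is the monic polynomial of least degree generating the ideal. $\mathcal{C}_{(i_1,i_2,\dots,i_t)}$ denotes the ternary cyclic code of length $3^m-1$ with generator polynomial $m_{\alpha^{i_1}}(x)m_{\alpha^{i_2}}(x)\cdots m_{\alpha^{i_t}}(x)$. A ternary $[n,k,d]$ code is optimal (in the standard sense) if no linear code over $\mathbb{F}_3$ of length $n$ and dimension $k$ has minimum distance larger than $d$. *)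

theory Defs
  imports
    "HOL-Library.Cardinality"
    "HOL-Algebra.QuotRing"
    "Jordan_Normal_Form.VS_Connect"
    "Jordan_Normal_Form.Ring_Hom_Matrix"
begin

text \<open>Linear codes over a field of type \<open>'k\<close>: subspaces of the coordinate space
  \<open>carrier_vec n\<close>, i.e. of \<open>'k\<^sup>n\<close> with coordinates indexed by \<open>0, \<dots>, n - 1\<close>.\<close>

definition hamming_dist :: "'k vec \<Rightarrow> 'k vec \<Rightarrow> nat" where
  "hamming_dist u v = card {i. i < dim_vec u \<and> u $ i \<noteq> v $ i}"

(* A code with fewer than two words has no minimum distance; Inf {} = 0 on nat. *)
definition min_dist :: "'k vec set \<Rightarrow> nat" where
  "min_dist C = Inf {hamming_dist u v | u v. u \<in> C \<and> v \<in> C \<and> u \<noteq> v}"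

definition code_dim :: "nat \<Rightarrow> 'k::field vec set \<Rightarrow> nat" where
  "code_dim n C = vectorspace.dim class_ring ((module_vec TYPE('k) n)\<lparr>carrier := C\<rparr>)"

definition linear_code :: "nat \<Rightarrow> nat \<Rightarrow> nat \<Rightarrow> 'k::field vec set \<Rightarrow> bool" where
  "linear_code n k d C \<longleftrightarrow>
     VectorSpace.subspace class_ring C (module_vec TYPE('k) n) \<and> code_dim n C = k \<and> min_dist C = d"

definition optimal_code :: "nat \<Rightarrow> nat \<Rightarrow> nat \<Rightarrow> 'k::field vec set \<Rightarrow> bool" where
  "optimal_code n k d C \<longleftrightarrow> linear_code n k d C \<and>
     (\<forall>(C' :: 'k vec set) d'. linear_code n k d' C' \<longrightarrow> d' \<le> d)"

definition code_poly :: "'k::comm_monoid_add vec \<Rightarrow> 'k poly" where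
  "code_poly c = (\<Sum>i<dim_vec c. Polynomial.monom (c $ i) i)"

text \<open>The quotient ring \<open>'k[x]/(x\<^sup>n - 1)\<close> and its canonical projection.\<close>

abbreviation cyclic_ideal :: "nat \<Rightarrow> 'k::field poly set" where
  "cyclic_ideal n \<equiv> PIdl\<^bsub>class_ring\<^esub> (Polynomial.monom 1 n - 1)"

definition cyclic_ring :: "nat \<Rightarrow> 'k::field poly set ring" where
  "cyclic_ring n = class_ring Quot cyclic_ideal n"

definition cyclic_residue :: "nat \<Rightarrow> 'k::field poly \<Rightarrow> 'k poly set" where
  "cyclic_residue n p = cyclic_ideal n +>\<^bsub>class_ring\<^esub> p"

definition cyclic_code :: "nat \<Rightarrow> 'k::field vec set \<Rightarrow> bool" where
  "cyclic_code n C \<longleftrightarrow> C \<subseteq> carrier_vec n \<and>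
     ideal ((\<lambda>c. cyclic_residue n (code_poly c)) ` C) (cyclic_ring n)"

definition generates_code :: "nat \<Rightarrow> 'k::field vec set \<Rightarrow> 'k poly \<Rightarrow> bool" where
  "generates_code n C g \<longleftrightarrow>
     (\<lambda>c. cyclic_residue n (code_poly c)) ` C = PIdl\<^bsub>cyclic_ring n\<^esub> (cyclic_residue n g)"

definition generator_polynomial :: "nat \<Rightarrow> 'k::field vec set \<Rightarrow> 'k poly \<Rightarrow> bool" where
  "generator_polynomial n C g \<longleftrightarrow> lead_coeff g = 1 \<and> generates_code n C g \<and>
     (\<forall>h. lead_coeff h = 1 \<and> generates_code n C h \<longrightarrow> degree g \<le> degree h)"

definition code_generated_by :: "nat \<Rightarrow> 'k::field poly \<Rightarrow> 'k vec set" where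
  "code_generated_by n g =
     {c \<in> carrier_vec n. cyclic_residue n (code_poly c) \<in> PIdl\<^bsub>cyclic_ring n\<^esub> (cyclic_residue n g)}"

text \<open>The minimal polynomial of \<open>\<beta>\<close> over \<open>'k\<close>, where the field extension is given by the
  embedding \<open>\<iota>\<close>.\<close>

definition minimal_poly :: "('k::field \<Rightarrow> 'a::field) \<Rightarrow> 'a \<Rightarrow> 'k poly" where
  "minimal_poly \<iota> \<beta> = (THE p. lead_coeff p = 1 \<and> poly (map_poly \<iota> p) \<beta> = 0 \<and>
     (\<forall>q. q \<noteq> 0 \<and> poly (map_poly \<iota> q) \<beta> = 0 \<longrightarrow> degree p \<le> degree q))"

text \<open>The cyclic code of length \<open>n\<close> whose generator polynomial is the product of the
  minimal polynomials of \<open>\<alpha>\<^sup>i\<close>, for \<open>i\<close> in the list \<open>is\<close>.\<close>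

definition exponent_poly :: "('k::field \<Rightarrow> 'a::field) \<Rightarrow> 'a \<Rightarrow> int list \<Rightarrow> 'k poly" where
  "exponent_poly \<iota> \<alpha> is = (\<Prod>i\<leftarrow>is. minimal_poly \<iota> (\<alpha> powi i))"

definition exponent_code :: "('k::field \<Rightarrow> 'a::field) \<Rightarrow> 'a \<Rightarrow> nat \<Rightarrow> int list \<Rightarrow> 'k vec set" where
  "exponent_code \<iota> \<alpha> n is = code_generated_by n (exponent_poly \<iota> \<alpha> is)"

definition mult_generator :: "'a::field \<Rightarrow> bool" where
  "mult_generator \<alpha> \<longleftrightarrow> range (\<lambda>j::int. \<alpha> powi j) = UNIV - {0}"

end

theory Submission
  imports Defs "Berlekamp_Zassenhaus.Berlekamp_Type_Based"
begin

text \<open>Write \<open>m = 2 h\<close>, \<open>n = 9 ^ h - 1\<close>, \<open>N x = x ^ (3 ^ h + 1)\<close> for the norm to the subfield with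
  \<open>3 ^ h\<close> elements and \<open>\<chi> x = x ^ s\<close> for the quadratic character, so that \<open>x ^ e = \<chi> x / N x\<close>.
  A word of weight 3 with signs \<open>a\<close>, \<open>b\<close>, \<open>c\<close> at the locators \<open>x\<close>, \<open>y\<close>, \<open>z\<close> satisfies
  \<open>a \<chi> x + b \<chi> y + c \<chi> z = 0\<close>, which in characteristic 3 makes the three terms equal. The other
  two equations then say that \<open>p = \<chi> x x\<close>, \<open>q = \<chi> y y\<close>, \<open>r = \<chi> z z\<close> have sum 0 and reciprocal
  norms of sum 0, which forces \<open>p = r\<close>. Weight 2 is excluded because \<open>\<chi> (- x) = \<chi> x\<close>. The
  conjugacy classes of \<open>\<alpha>\<close>, \<open>\<alpha> ^ e\<close>, \<open>\<alpha> ^ s = - 1\<close> have \<open>2 h\<close>, \<open>h\<close> and 1 elements, which gives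
  the dimension, and minimum distance 5 would contradict sphere packing.\<close>

section \<open>Power sums in characteristic 3\<close>

text \<open>Multiplication by \<open>x\<close> permutes the nonzero elements, so it fixes their
  product, which is then cancelled.\<close>

lemma finite_field_power_card_minus_one:
  fixes x :: "'a::{field,finite}"
  assumes "x \<noteq> 0"
  shows "x ^ (CARD('a) - 1) = 1"
proof -
  have "(\<Prod>y\<in>UNIV-{0}. x * y) = (\<Prod>y\<in>UNIV-{0::'a}. y)"
    by (rule prod.reindex_bij_witness[of _ "\<lambda>y. y / x" "\<lambda>y. x * y"]) (use assms in auto)
  moreover have "(\<Prod>y\<in>UNIV-{0}. x * y) = x ^ (CARD('a) - 1) * (\<Prod>y\<in>UNIV-{0::'a}. y)"
    by (simp add: prod.distrib card_Diff_singleton)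
  moreover have "(\<Prod>y\<in>UNIV-{0::'a}. y) \<noteq> 0" by simp
  ultimately show ?thesis by simp
qed

lemma finite_field_power_card:
  fixes x :: "'a::{field,finite}"
  shows "x ^ CARD('a) = x"
proof (cases "x = 0")
  case False
  have "x ^ CARD('a) = x * x ^ (CARD('a) - 1)"
    by (subst power_eq_if) (simp add: zero_less_card_finite)
  then show ?thesis using finite_field_power_card_minus_one[OF False] by simp
qed (simp add: zero_less_card_finite)

text \<open>The trace \<open>t = u + \<sigma> u\<close> and the norm \<open>n = u * \<sigma> u\<close> satisfy
  \<open>t * (n + 1) = - (n\<^sup>2 + 1)\<close>, so in characteristic 3 the discriminant \<open>(u - \<sigma> u)\<^sup>2\<close> times
  \<open>(n + 1)\<^sup>2\<close> is \<open>(n - 1) ^ 4\<close>. Hence \<open>(u - \<sigma> u) * (n + 1)\<close>, which \<open>\<sigma>\<close> negates, is fixed by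
  \<open>\<sigma>\<close> as well.\<close>

lemma inverse_norm_sum_eq_0:
  fixes u v :: "'a::field" and \<sigma> :: "'a \<Rightarrow> 'a"
  assumes three: "(3::'a) = 0"
    and add: "\<And>x y. \<sigma> (x + y) = \<sigma> x + \<sigma> y" and mult: "\<And>x y. \<sigma> (x * y) = \<sigma> x * \<sigma> y"
    and one: "\<sigma> 1 = 1" and invol: "\<And>x. \<sigma> (\<sigma> x) = x"
    and "u \<noteq> 0" "v \<noteq> 0" and uv: "u + v + 1 = 0"
    and sum: "inverse (u * \<sigma> u) + inverse (v * \<sigma> v) + 1 = 0"
  shows "u = 1"
proof -
  have zero: "\<sigma> 0 = 0" using add[of 0 0] by (metis add_cancel_right_right add_0)
  have minus: "\<sigma> (- x) = - \<sigma> x" for x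
    using add[of x "- x"] zero by (simp add: eq_neg_iff_add_eq_0 add.commute)
  have diff: "\<sigma> (x - y) = \<sigma> x - \<sigma> y" for x y
    using add[of x "- y"] minus by simp
  have \<sigma>0: "\<sigma> x = 0 \<Longrightarrow> x = 0" for x using invol[of x] zero by simp
  define b where "b = \<sigma> u"
  define n where "n = u * b"
  have v: "v = - 1 - u" using uv by (simp add: algebra_simps eq_neg_iff_add_eq_0)
  have sv: "\<sigma> v = - 1 - b" unfolding v b_def by (simp add: diff minus one)
  have "u * b \<noteq> 0" "v * \<sigma> v \<noteq> 0" using assms(6,7) \<sigma>0 by (auto simp: b_def)
  then have "v * \<sigma> v + u * b + (u * b) * (v * \<sigma> v) = 0"
    using sum by (simp add: field_simps b_def)
  then have "(- 1 - u) * (- 1 - b) + u * b + (u * b) * ((- 1 - u) * (- 1 - b)) = 0"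
    unfolding sv unfolding v .
  moreover have "(- 1 - u) * (- 1 - b) + u * b + (u * b) * ((- 1 - u) * (- 1 - b))
      = (u + b) * (n + 1) + (n\<^sup>2 + 1) + 3 * n"
    unfolding n_def by (simp add: algebra_simps power2_eq_square)
  ultimately have "(u + b) * (n + 1) + (n\<^sup>2 + 1) + 3 * n = 0" by simp
  then have T: "(u + b) * (n + 1) = - (n\<^sup>2 + 1)" 
    unfolding eq_neg_iff_add_eq_0 using three by simp
  define w where "w = (u - b) * (n + 1)"
  have "w\<^sup>2 = ((u + b) * (n + 1))\<^sup>2 - 4 * n * (n + 1)\<^sup>2" unfolding w_def n_def
    by (simp add: algebra_simps power2_eq_square)
  also have "\<dots> = ((n - 1)\<^sup>2)\<^sup>2 - 3 * (4 * n\<^sup>2)" unfolding T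
    by (simp add: algebra_simps power2_eq_square)
  finally have "w\<^sup>2 = ((n - 1)\<^sup>2)\<^sup>2" using three by simp
  then have w: "w = (n - 1)\<^sup>2 \<or> w = - ((n - 1)\<^sup>2)" by (rule power2_eq_iff[THEN iffD1])
  have \<sigma>n: "\<sigma> n = n" unfolding n_def b_def by (simp add: mult invol)
  have "\<sigma> ((n - 1)\<^sup>2) = (n - 1)\<^sup>2" by (simp add: power2_eq_square mult diff \<sigma>n one)
  then have "\<sigma> w = w" using w minus by auto
  moreover have "\<sigma> w = - w" unfolding w_def
    by (simp add: mult diff add \<sigma>n one) (simp add: b_def invol algebra_simps)
  ultimately have "w + w = 0" by (simp add: eq_neg_iff_add_eq_0)
  then have "3 * w - w = 0" by (simp add: algebra_simps)
  then have w0: "w = 0" using three by simp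
  then have n1: "n = 1" using w by simp
  have two: "(2::'a) = - 1" using three by (simp add: eq_neg_iff_add_eq_0)
  have "u = b" using w0 unfolding w_def n1 by (simp add: two)
  \<comment> \<open>With \<open>n = 1\<close> and \<open>u = b\<close> the trace relation reads 4 u
    = -2, which is \<open>u = 1\<close> in characteristic 3.\<close>
  then have "(u + u) * (1 + 1) = - (1 + 1)" using T unfolding n1 by simp
  then show "u = 1" by (simp add: two)
qed

section \<open>Consequences of characteristic 3\<close>

lemma freshmans_dream_3:
  fixes x y :: "'a::field"
  assumes "CHAR('a) = 3"
  shows "(x + y) ^ (3 ^ h) = x ^ (3 ^ h) + y ^ (3 ^ h)"
  by (rule freshmans_dream') (use assms in auto)

lemma CHAR_eq_3:
  assumes "CARD('a::{field,finite}) = 3 ^ j"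
  shows "CHAR('a) = 3"
proof -
  have "prime CHAR('a)"
    by (rule prime_CHAR_semidom) (rule finite_imp_CHAR_pos, simp)
  moreover have "CHAR('a) dvd 3 ^ j" using CHAR_dvd_CARD[where 'a = 'a] assms by simp
  ultimately have "CHAR('a) dvd 3" using prime_dvd_power by blast
  then show ?thesis using \<open>prime CHAR('a)\<close> by (simp add: primes_dvd_imp_eq)
qed

lemma CHAR_3_numeral:
  assumes "CHAR('a::field) = 3"
  shows "(3::'a) = 0"
  using of_nat_CHAR[where 'a = 'a] unfolding assms by simp

lemma one_neq_minus_one:
  assumes "CHAR('a::field) = 3"
  shows "(1::'a) \<noteq> - 1"
proof
  assume "(1::'a) = - 1"
  then have "(1::'a) + 1 = 0" by (simp add: eq_neg_iff_add_eq_0)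
  then have "of_nat 2 = (0::'a)" by simp
  then have "(3::nat) dvd 2" using assms by (metis of_nat_eq_0_iff_char_dvd)
  then show False by simp
qed

text \<open>Three signs add up to 1, -1, 3 or -3, and only the last two vanish in characteristic
  3.\<close>

lemma sign_sum_eq_0:
  fixes x y z :: "'a::field"
  assumes "CHAR('a) = 3" and "x = 1 \<or> x = - 1" "y = 1 \<or> y = - 1" "z = 1 \<or> z = - 1"
    and "x + y + z = 0"
  shows "x = y \<and> x = z"
  using assms(2-5) one_neq_minus_one[OF assms(1)] by (elim disjE) auto

text \<open>Half the order of the multiplicative group of the field with \<open>9 ^ h\<close>
  elements: the exponent \<open>s\<close> of the theorem as a natural number.\<close>

definition half_order :: "nat \<Rightarrow> nat" where
  "half_order h = (9 ^ h - 1) div 2"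

lemma half_order_double: "2 * half_order h = 9 ^ h - 1"
proof -
  have "odd (9 ^ h :: nat)" by simp
  then show ?thesis unfolding half_order_def by presburger
qed

text \<open>Since \<open>9 ^ h\<close> is 1 modulo 4, its predecessor is divisible by 4. Hence
  \<open>\<chi>\<close> takes equal values at \<open>x\<close> and \<open>- x\<close>.\<close>

lemma even_half_order: "even (half_order h)"
proof -
  have "[9 ^ h = 1 ^ h] (mod (4::nat))" by (rule cong_pow) (simp add: cong_def)
  then have "4 dvd (9 ^ h - 1 :: nat)"
    by (simp add: cong_altdef_nat)
  then show ?thesis using half_order_double[of h] by presburger
qed

text \<open>Makes the exponent \<open>e\<close> nonnegative, so that a natural number
  \<open>E\<close> can replace it. Equality occurs for \<open>h = 1\<close>, where
  \<open>E = 0\<close>.\<close>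

lemma three_power_lt_half_order:
  assumes "h > 0"
  shows "3 ^ h + 1 \<le> half_order h"
proof -
  have "(3::nat) ^ h \<ge> 3 ^ 1" using assms by (intro power_increasing) auto
  moreover have "(9::nat) ^ h = 3 ^ h * 3 ^ h" by (simp flip: power_mult_distrib)
  ultimately have "(9::nat) ^ h \<ge> 3 * 3 ^ h" by (metis mult_le_mono1 power_one_right)
  then show ?thesis using \<open>(3::nat) ^ h \<ge> 3 ^ 1\<close> half_order_double[of h] by simp
qed

section \<open>Excluding words of weight two and three\<close>

context
  fixes h :: nat and E :: nat
  assumes h: "h > 0" and card: "CARD('a::{field,finite}) = 9 ^ h"
    and E: "E + (3 ^ h + 1) = half_order h"
begin

lemma CHAR_eq_3_of_card: "CHAR('a) = 3"
  by (rule CHAR_eq_3[of "2 * h"]) (simp add: card power_mult)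

lemma half_order_power:
  assumes "(x::'a) \<noteq> 0"
  shows "x ^ half_order h = 1 \<or> x ^ half_order h = - 1"
proof -
  have "(x ^ half_order h)\<^sup>2 = 1"
    using finite_field_power_card_minus_one[OF assms]
    by (simp add: card half_order_double flip: power_mult mult.commute[of 2])
  then show ?thesis by (simp add: power2_eq_1_iff)
qed

text \<open>The division-free form of \<open>x ^ e = \<chi> x / N x\<close>.\<close>

lemma power_E: "(x::'a) ^ E * x ^ (3 ^ h + 1) = x ^ half_order h"
  unfolding E[symmetric] by (simp only: power_add)

text \<open>Opposite entries \<open>a\<close>, \<open>b\<close> would give \<open>x = y\<close>, and
  equal ones give \<open>y = - x\<close>. As \<open>x\<close> and \<open>- x\<close> have the same
  character, the second sum is then twice a nonzero element.\<close>

lemma weight_two: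
  fixes x y a b :: 'a
  assumes "x \<noteq> 0" "y \<noteq> 0" "x \<noteq> y"
    and a: "a = 1 \<or> a = - 1" and b: "b = 1 \<or> b = - 1"
    and 1: "a * x + b * y = 0" and 2: "a * x ^ half_order h + b * y ^ half_order h = 0"
  shows False
proof -
  have "a \<noteq> 0" using a by auto
  have "a * x - a * y \<noteq> 0" using \<open>a \<noteq> 0\<close> \<open>x \<noteq> y\<close> by simp
  then have "a = b" using a b 1 by auto
  then have "a * (x + y) = 0" using 1 by (simp add: distrib_left)
  then have "y = - x" using \<open>a \<noteq> 0\<close> by (simp add: add_eq_0_iff)
  then have "a * x ^ half_order h + a * x ^ half_order h = 0"
    using 2 \<open>a = b\<close> even_half_order by (simp add: power_minus_even)
  then have "a * x ^ half_order h * (1 + 1) = 0" by (simp add: algebra_simps)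
  then show False using a \<open>x \<noteq> 0\<close> one_neq_minus_one[OF CHAR_eq_3_of_card]
    by (auto simp: eq_neg_iff_add_eq_0)
qed

text \<open>Once the common sign is factored out, the first two equations are homogeneous in
  \<open>p\<close>, \<open>q\<close>, \<open>r\<close>. Dividing by \<open>r\<close> gives the
  normalised situation of \<open>inverse_norm_sum_eq_0\<close>.\<close>

lemma weight_three:
  fixes x y z a b c :: 'a
  assumes nz: "x \<noteq> 0" "y \<noteq> 0" "z \<noteq> 0" and "x \<noteq> y" "x \<noteq> z" "y \<noteq> z"
    and a: "a = 1 \<or> a = - 1" and b: "b = 1 \<or> b = - 1" and c: "c = 1 \<or> c = - 1"
    and 1: "a * x + b * y + c * z = 0"
    and 2: "a * x ^ E + b * y ^ E + c * z ^ E = 0"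
    and 3: "a * x ^ half_order h + b * y ^ half_order h + c * z ^ half_order h = 0"
  shows False
proof -
  define \<chi> where "\<chi> = (\<lambda>x::'a. x ^ half_order h)"
  define N where "N = (\<lambda>x::'a. x * x ^ (3 ^ h))"
  have three: "(3::'a) = 0" by (rule CHAR_3_numeral[OF CHAR_eq_3_of_card])
  have \<chi>: "\<chi> w = 1 \<or> \<chi> w = - 1" if "w \<noteq> 0" for w
    unfolding \<chi>_def by (rule half_order_power[OF that])
  have E': "w ^ E = \<chi> w * inverse (N w)" if "w \<noteq> 0" for w
    using power_E[of w] that by (simp add: N_def \<chi>_def field_simps)
  \<comment> \<open>The two factors of \<open>N\<close> change sign together, so the norm does not
    see the sign \<open>\<chi> w\<close>.\<close>
  have N\<chi>: "N (\<chi> w * w) = N w" if "w \<noteq> 0" for w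
    using \<chi>[OF that] by (auto simp: N_def)
  have "a * \<chi> x = b * \<chi> y \<and> a * \<chi> x = c * \<chi> z"
    by (rule sign_sum_eq_0[OF CHAR_eq_3_of_card]) (use a b c \<chi>[OF nz(1)] \<chi>[OF nz(2)] \<chi>[OF nz(3)] 3 in \<open>auto simp: \<chi>_def\<close>)
  then obtain e where e: "a * \<chi> x = e" "b * \<chi> y = e" "c * \<chi> z = e" by auto
  have sq: "\<chi> w * \<chi> w = 1" if "w \<noteq> 0" for w using \<chi>[OF that] by auto
  have "e \<noteq> 0" using e(1) a \<chi>[OF nz(1)] by auto
  have "a = (a * \<chi> x) * \<chi> x" "b = (b * \<chi> y) * \<chi> y" "c = (c * \<chi> z) * \<chi> z"
    by (simp_all add: mult.assoc sq nz)
  \<comment> \<open>Characters square to 1, so each entry is the common sign \<open>e\<close> times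
    the character of its locator.\<close>
  then have abc: "a = e * \<chi> x" "b = e * \<chi> y" "c = e * \<chi> z" unfolding e .
  define p q r where "p = \<chi> x * x" and "q = \<chi> y * y" and "r = \<chi> z * z"
  have nz': "p \<noteq> 0" "q \<noteq> 0" "r \<noteq> 0" using nz by (auto simp: p_def q_def r_def \<chi>_def)
  have "e * (p + q + r) = 0" using 1 unfolding abc p_def q_def r_def by (simp add: algebra_simps)
  then have pqr: "p + q + r = 0" using \<open>e \<noteq> 0\<close> by simp
  have "e * (\<chi> x * \<chi> x * inverse (N x) + \<chi> y * \<chi> y * inverse (N y) + \<chi> z * \<chi> z * inverse (N z)) = 0"
    using 2 unfolding E'[OF nz(1)] E'[OF nz(2)] E'[OF nz(3)] unfolding abc by (simp add: algebra_simps)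
  then have Npqr: "inverse (N p) + inverse (N q) + inverse (N r) = 0"
    using \<open>e \<noteq> 0\<close> unfolding p_def q_def r_def N\<chi>[OF nz(1)] N\<chi>[OF nz(2)] N\<chi>[OF nz(3)]
      sq[OF nz(1)] sq[OF nz(2)] sq[OF nz(3)] by simp
  have Ndiv: "inverse (N (v / r)) = N r * inverse (N v)" for v
    by (simp only: N_def power_divide times_divide_times_eq inverse_divide) (simp add: divide_inverse)
  have "p / r = 1"
  \<comment> \<open>The power by \<open>3 ^ h\<close> is an involution because applying it twice is
    the power by \<open>9 ^ h\<close>, the cardinality of the field.\<close>
  proof (rule inverse_norm_sum_eq_0[where \<sigma> = "\<lambda>x. x ^ (3 ^ h)" and v = "q / r"])
    show "(x + y) ^ (3 ^ h) = x ^ (3 ^ h) + y ^ (3 ^ h)" for x y :: 'a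
      by (rule freshmans_dream_3[OF CHAR_eq_3_of_card])
    show "(x ^ 3 ^ h) ^ 3 ^ h = x" for x :: 'a
      using finite_field_power_card[of x] unfolding card
      by (simp flip: power_mult power_mult_distrib)
    have "p / r + q / r + 1 = (p + q + r) / r" using nz' by (simp add: add_divide_distrib)
    then show "p / r + q / r + 1 = 0" using pqr by simp
    have "inverse (N (p / r)) + inverse (N (q / r)) + 1
        = N r * (inverse (N p) + inverse (N q) + inverse (N r))"
      unfolding Ndiv using nz' by (simp add: algebra_simps N_def)
    then show "inverse (p / r * (p / r) ^ 3 ^ h) + inverse (q / r * (q / r) ^ 3 ^ h) + 1 = 0"
      using Npqr by (simp add: N_def)
  qed (use nz' three in \<open>auto simp: power_mult_distrib\<close>)
  then have "p = r" using nz' by simp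
  then have "\<chi> p = \<chi> r" by simp
  \<comment> \<open>A sign does not change the character, so \<open>p = r\<close> gives
    \<open>\<chi> x = \<chi> z\<close> and then \<open>x = z\<close>.\<close>
  moreover have "\<chi> (\<chi> w * w) = \<chi> w" if "w \<noteq> 0" for w
    using \<chi>[OF that] even_half_order by (auto simp: \<chi>_def power_minus_even)
  ultimately have "\<chi> x = \<chi> z" using nz by (simp add: p_def r_def)
  then show False using \<open>p = r\<close> nz \<open>x \<noteq> z\<close> by (simp add: p_def r_def \<chi>_def)
qed

end

section \<open>Minimal polynomials\<close>

context field_hom
begin

sublocale poly_hom: map_poly_inj_idom_hom hom ..

text \<open>An annihilator of least degree divides all others, since a nonzero remainder would have
  smaller degree. Two monic ones divide each other and coincide, so the \<open>THE\<close> in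
  \<open>minimal_poly\<close> is well defined.\<close>

lemma minimal_poly_characterization:
  assumes "q0 \<noteq> 0" "poly (map_poly hom q0) \<beta> = 0"
  shows "lead_coeff (minimal_poly hom \<beta>) = 1"
    and "poly (map_poly hom q) \<beta> = 0 \<longleftrightarrow> minimal_poly hom \<beta> dvd q"
proof -
  define R where "R = (\<lambda>q. poly (map_poly hom q) \<beta> = 0)"
  define P where "P = (\<lambda>p. lead_coeff p = 1 \<and> R p \<and> (\<forall>q. q \<noteq> 0 \<and> R q \<longrightarrow> degree p \<le> degree q))"
  have R_dvd: "R (p * q)" if "R p" for p q
    using that by (simp add: R_def hom_distribs)
  have dvd: "p dvd q" if "P p" "R q" for p q
  proof -
    have "p \<noteq> 0" using that(1) by (auto simp: P_def)
    have "map_poly hom q = map_poly hom p * map_poly hom (q div p) + map_poly hom (q mod p)"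
      by (simp flip: poly_hom.hom_mult poly_hom.hom_add)
    then have "R (q mod p)" using that unfolding R_def P_def by simp
    then show ?thesis
      using that(1) degree_mod_less[OF \<open>p \<noteq> 0\<close>, of q] unfolding P_def
      by (auto simp: dvd_eq_mod_eq_0 not_less)
  qed
  obtain p0 where p0: "p0 \<noteq> 0 \<and> R p0" and min: "\<And>q. q \<noteq> 0 \<and> R q \<Longrightarrow> degree p0 \<le> degree q"
    using ex_has_least_nat[of "\<lambda>p. p \<noteq> 0 \<and> R p" q0 degree] assms unfolding R_def by blast
  have "P (Polynomial.smult (inverse (lead_coeff p0)) p0)"
    using p0 min by (auto simp: P_def R_def hom_distribs)
  moreover have "p = p'" if "P p" "P p'" for p p'
  proof -
    have "p dvd p'" "p' dvd p" using dvd that unfolding P_def by blast+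
    moreover have "lead_coeff p = lead_coeff p'" using that by (simp add: P_def)
    ultimately show ?thesis using poly_dvd_antisym by blast
  qed
  ultimately have "\<exists>!p. P p" by blast
  then have "P (THE p. P p)" by (rule theI')
  then have m: "P (minimal_poly hom \<beta>)" by (simp add: minimal_poly_def P_def R_def)
  then show "lead_coeff (minimal_poly hom \<beta>) = 1" by (simp add: P_def)
  have "R (minimal_poly hom \<beta>)" using m by (simp add: P_def)
  then have "R q" if "minimal_poly hom \<beta> dvd q" using that R_dvd by (metis dvdE)
  then have "R q \<longleftrightarrow> minimal_poly hom \<beta> dvd q" using dvd[OF m] by metis
  then show "poly (map_poly hom q) \<beta> = 0 \<longleftrightarrow> minimal_poly hom \<beta> dvd q" by (simp only: R_def)
qed

end

locale finite_field_extension = field_hom \<iota>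
  for \<iota> :: "'k::{field,finite} \<Rightarrow> 'a::{field,finite}"
begin

lemma annihilating_poly_exists: "\<exists>q. q \<noteq> 0 \<and> poly (map_poly \<iota> q) \<beta> = 0"
proof (intro exI conjI)
  \<comment> \<open>Every element of a field with q elements is a root of \<open>x ^ q - x\<close>;
    because q is at least 2, the two monomials differ.\<close>
  let ?q = "Polynomial.monom 1 CARD('a) - Polynomial.monom 1 1 :: 'k poly"
  have "card {0, 1 :: 'a} \<le> CARD('a)" by (rule card_mono) auto
  then have "coeff ?q 1 = - 1" by simp
  moreover have "coeff (0 :: 'k poly) 1 \<noteq> - 1" by simp
  ultimately show "?q \<noteq> 0" by (intro notI) (simp only:)
  show "poly (map_poly \<iota> ?q) \<beta> = 0"
    by (simp add: hom_distribs poly_monom finite_field_power_card)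
qed

lemma minimal_poly_monic: "lead_coeff (minimal_poly \<iota> \<beta>) = 1"
  and minimal_poly_dvd_iff: "minimal_poly \<iota> \<beta> dvd q \<longleftrightarrow> poly (map_poly \<iota> q) \<beta> = 0"
  using annihilating_poly_exists[of \<beta>] minimal_poly_characterization by blast+

lemma minimal_poly_nonzero: "minimal_poly \<iota> \<beta> \<noteq> 0"
  using minimal_poly_monic[of \<beta>] by (metis leading_coeff_0_iff zero_neq_one)

lemma minimal_poly_root: "poly (map_poly \<iota> (minimal_poly \<iota> \<beta>)) \<beta> = 0"
  by (rule minimal_poly_dvd_iff[THEN iffD1]) (rule dvd_refl)

text \<open>Divisibility is vanishing at \<open>\<beta>\<close>, and the values there lie in a
  field, which has no zero divisors.\<close>

lemma minimal_poly_dvd_mult: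
  assumes "minimal_poly \<iota> \<beta> dvd p * q"
  shows "minimal_poly \<iota> \<beta> dvd p \<or> minimal_poly \<iota> \<beta> dvd q"
  using assms by (simp add: minimal_poly_dvd_iff hom_distribs)

text \<open>Non-vanishing of \<open>q\<close> at \<open>\<beta>\<close> stands in for coprimality of
  \<open>q\<close> with the minimal polynomial.\<close>

lemma minimal_poly_mult_dvd:
  assumes "minimal_poly \<iota> \<beta> dvd p" "q dvd p" "poly (map_poly \<iota> q) \<beta> \<noteq> 0"
  shows "minimal_poly \<iota> \<beta> * q dvd p"
proof -
  obtain r where r: "p = q * r" using assms(2) by (rule dvdE)
  then have "minimal_poly \<iota> \<beta> dvd r"
    using minimal_poly_dvd_mult[of \<beta> q r] assms(1,3) unfolding minimal_poly_dvd_iff by blast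
  then have "minimal_poly \<iota> \<beta> * q dvd r * q" by (rule mult_dvd_mono) simp
  then show ?thesis unfolding r by (simp add: mult.commute)
qed

end


section \<open>Words as polynomials\<close>

lemma coeff_code_poly: "coeff (code_poly c) i = (if i < dim_vec c then c $ i else 0)"
  unfolding code_poly_def by (simp add: coeff_sum sum.delta)

text \<open>The zero polynomial has degree 0, so for \<open>n = 0\<close> the set on the right would
  be empty although there is one empty word.\<close>

lemma bij_betw_code_poly:
  assumes "n > 0"
  shows "bij_betw code_poly (carrier_vec n) {p :: 'k::field poly. degree p < n}"
proof (rule bij_betwI[where g = "\<lambda>p. vec n (coeff p)"])
  show "code_poly \<in> carrier_vec n \<rightarrow> {p :: 'k poly. degree p < n}"
  proof
    fix c :: "'k vec" assume "c \<in> carrier_vec n"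
    then have "\<forall>i>n - 1. coeff (code_poly c) i = 0" by (auto simp: coeff_code_poly)
    then have "degree (code_poly c) \<le> n - 1" by (rule degree_le)
    then show "code_poly c \<in> {p. degree p < n}" using assms by simp
  qed
  show "code_poly (vec n (coeff p)) = p" if "p \<in> {p. degree p < n}" for p :: "'k poly"
    using that by (intro poly_eqI) (auto simp: coeff_code_poly coeff_eq_0)
qed (auto simp: coeff_code_poly)

lemma card_poly_degree_less:
  assumes "n > 0"
  shows "card {p :: 'k::{field,finite} poly. degree p < n} = CARD('k) ^ n"
  using bij_betw_same_card[OF bij_betw_code_poly[OF assms, where 'k = 'k]]
  by (simp add: card_carrier_vec)

section \<open>Conjugates over the field with three elements\<close>

locale ternary_extension = finite_field_extension \<iota>
  for \<iota> :: "'k::{field,finite} \<Rightarrow> 'a::{field,finite}" +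
  assumes card_k: "CARD('k) = 3"
begin

lemma char_3: "CHAR('a) = 3"
proof -
  have "CHAR('k) = 3" by (rule CHAR_eq_3[of 1]) (simp add: card_k)
  then have "\<iota> 3 = 0" using CHAR_3_numeral by (metis hom_zero)
  then have "of_nat 3 = (0::'a)" by (simp add: hom_distribs)
  then have "CHAR('a) dvd 3" by (metis of_nat_eq_0_iff_char_dvd)
  moreover have "prime CHAR('a)"
    by (rule prime_CHAR_semidom) (rule finite_imp_CHAR_pos, simp)
  ultimately show ?thesis by (simp add: primes_dvd_imp_eq)
qed

lemma power_3_power: "(a::'k) ^ (3 ^ j) = a"
  using finite_field_power_card[where 'a = 'k] unfolding card_k
  by (induction j) (simp_all add: power_mult)

text \<open>The power by \<open>3 ^ j\<close> is additive and fixes the coefficients, so it passes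
  through the Horner form to the argument.\<close>

lemma frobenius_poly: "poly (map_poly \<iota> p) x ^ (3 ^ j) = poly (map_poly \<iota> p) (x ^ (3 ^ j))"
proof (induction p)
  case 0
  then show ?case by (simp add: power_0_left)
next
  case (pCons a p)
  have "\<iota> a ^ (3 ^ j) = \<iota> a" using power_3_power[of a j] by (metis hom_power)
  moreover have "map_poly \<iota> (pCons a p) = pCons (\<iota> a) (map_poly \<iota> p)"
    by (rule Polynomial.map_poly_pCons) (rule hom_zero)
  ultimately show ?case
    by (simp only: poly_pCons freshmans_dream_3[OF char_3]
        power_mult_distrib pCons.IH)
qed

lemma minimal_poly_conjugate:
  "poly (map_poly \<iota> (minimal_poly \<iota> \<beta>)) (\<beta> ^ (3 ^ j)) = 0"
  using frobenius_poly[of "minimal_poly \<iota> \<beta>" \<beta> j] minimal_poly_root[of \<beta>] by (simp add: power_0_left)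

text \<open>Distinct conjugates are distinct roots, and the degree bounds the number of
  roots.\<close>

lemma degree_minimal_poly_ge:
  assumes "inj_on (\<lambda>j. \<beta> ^ (3 ^ j)) {..<d}"
  shows "d \<le> degree (minimal_poly \<iota> \<beta>)"
proof -
  let ?p = "map_poly \<iota> (minimal_poly \<iota> \<beta>)"
  have p: "?p \<noteq> 0" using minimal_poly_nonzero by simp
  have "d = card ((\<lambda>j. \<beta> ^ (3 ^ j)) ` {..<d})"
    by (subst card_image[OF assms]) (rule card_lessThan[symmetric])
  also have "\<dots> \<le> card {x. poly ?p x = 0}"
    by (rule card_mono) (simp_all only: finite image_subset_iff mem_Collect_eq minimal_poly_conjugate, simp)
  also have "\<dots> \<le> degree ?p" by (rule card_poly_roots_bound[OF p])
  finally show ?thesis by simp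
qed

text \<open>Pigeonhole: the \<open>3 ^ (d + 1)\<close> polynomials of degree at most \<open>d\<close> take at most \<open>3 ^ d\<close>
  values at \<open>\<beta>\<close>, all of them roots of \<open>x ^ (3 ^ d) - x\<close>.\<close>

lemma degree_minimal_poly_le:
  assumes "\<beta> ^ (3 ^ d) = \<beta>" "d > 0"
  shows "degree (minimal_poly \<iota> \<beta>) \<le> d"
proof -
  let ?q = "Polynomial.monom 1 (3 ^ d) - Polynomial.monom 1 1 :: 'a poly"
  have d: "(3::nat) ^ d \<noteq> 1" using \<open>d > 0\<close> by simp
  then have "coeff ?q 1 = - 1" by simp
  moreover have "coeff (0 :: 'a poly) 1 \<noteq> - 1" by simp
  ultimately have q: "?q \<noteq> 0" by (intro notI) (simp only:)
  have "degree ?q \<le> 3 ^ d"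
    by (rule degree_diff_le) (simp_all add: degree_monom_eq)
  define ev where "ev = (\<lambda>p. poly (map_poly \<iota> p) \<beta>)"
  have "poly ?q (ev p) = 0" for p
  proof -
    have "ev p ^ (3 ^ d) = ev p" unfolding ev_def frobenius_poly assms(1) ..
    then show ?thesis by (simp add: poly_monom)
  qed
  then have "ev ` {p. degree p < d + 1} \<subseteq> {x. poly ?q x = 0}" by blast
  then have "card (ev ` {p. degree p < d + 1}) \<le> card {x. poly ?q x = 0}"
    by (rule card_mono[OF finite])
  also have "\<dots> \<le> degree ?q" by (rule card_poly_roots_bound[OF q])
  also have "\<dots> \<le> 3 ^ d" by fact
  also have "3 ^ d < card {p :: 'k poly. degree p < d + 1}"
    by (subst card_poly_degree_less) (simp_all add: card_k)
  finally have "\<not> inj_on ev {p. degree p < d + 1}" by (rule pigeonhole)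
  then obtain p p' where p: "degree p < d + 1" "degree p' < d + 1" "p \<noteq> p'" "ev p = ev p'"
    by (auto simp: inj_on_def)
  then have "minimal_poly \<iota> \<beta> dvd p - p'" unfolding minimal_poly_dvd_iff
    by (simp add: hom_distribs ev_def)
  then have "degree (minimal_poly \<iota> \<beta>) \<le> degree (p - p')"
    using p(3) by (intro dvd_imp_degree_le) auto
  also have "\<dots> \<le> d" using p by (intro degree_diff_le) auto
  finally show ?thesis .
qed

end

section \<open>Cyclic codes\<close>

lemma PIdl_class_ring: "PIdl\<^bsub>class_ring\<^esub> (a::'a::comm_ring_1) = {p. a dvd p}"
  unfolding cgenideal_def dvd_def by (simp add: mult.commute[of a])

lemma cyclic_ideal: "ideal (cyclic_ideal n :: 'k::field poly set) class_ring"
  by (rule cring.cgenideal_ideal[OF class_cring.cring_axioms]) simp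

lemma cyclic_ring: "cring (cyclic_ring n :: 'k::field poly set ring)"
  unfolding cyclic_ring_def
  by (rule ideal.quotient_is_cring[OF cyclic_ideal class_cring.cring_axioms])

context
  fixes n :: nat
begin

lemma cyclic_residue_eq_iff:
  "cyclic_residue n p = cyclic_residue n q \<longleftrightarrow> Polynomial.monom 1 n - 1 dvd p - (q :: 'k::field poly)"
proof -
  have r: "cyclic_residue n p = {x. Polynomial.monom 1 n - 1 dvd x - p}" for p :: "'k poly"
  proof -
    have "cyclic_residue n p = (\<Union>h\<in>{h. Polynomial.monom 1 n - 1 dvd h}. {h + p})"
      unfolding cyclic_residue_def a_r_coset_def' PIdl_class_ring by (simp only: ring_record_simps)
    also have "\<dots> = {x. Polynomial.monom 1 n - 1 dvd x - p}"
    proof (intro equalityI subsetI)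
      fix x assume "x \<in> {x. Polynomial.monom 1 n - 1 dvd x - p}"
      then show "x \<in> (\<Union>h\<in>{h. Polynomial.monom 1 n - 1 dvd h}. {h + p})"
        by (intro UN_I[of "x - p"]) simp_all
    qed auto
    finally show ?thesis .
  qed
  show ?thesis
  proof
    assume "cyclic_residue n p = cyclic_residue n q"
    moreover have "p \<in> cyclic_residue n p" unfolding r by simp
    ultimately show "Polynomial.monom 1 n - 1 dvd p - q" unfolding r by simp
  next
    assume *: "Polynomial.monom 1 n - 1 dvd p - q"
    have "Polynomial.monom 1 n - 1 dvd x - p \<longleftrightarrow> Polynomial.monom 1 n - 1 dvd x - q" for x
      using dvd_add_right_iff[OF *, of "x - p"] by simp
    then show "cyclic_residue n p = cyclic_residue n q" unfolding r by simp
  qed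
qed

lemma carrier_cyclic_ring: "carrier (cyclic_ring n) = range (cyclic_residue n :: 'k::field poly \<Rightarrow> _)"
  unfolding cyclic_ring_def FactRing_def A_RCOSETS_def' cyclic_residue_def by auto

text \<open>Every element of the quotient is the residue of a polynomial \<open>f\<close>, and
  residues multiply like polynomials.\<close>

lemma PIdl_cyclic_ring:
  "PIdl\<^bsub>cyclic_ring n\<^esub> (cyclic_residue n g) = range (\<lambda>f. cyclic_residue n (f * g :: 'k::field poly))"
proof -
  have "cyclic_residue n f \<otimes>\<^bsub>cyclic_ring n\<^esub> cyclic_residue n g = cyclic_residue n (f * g)" for f
    unfolding cyclic_ring_def cyclic_residue_def
    using ring_hom_mult[OF ideal.rcos_ring_hom[OF cyclic_ideal], of f g] by simp
  then show ?thesis unfolding cgenideal_def carrier_cyclic_ring by auto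
qed

text \<open>The remainder modulo \<open>x ^ n - 1\<close> has degree below \<open>n\<close>, hence
  is the polynomial of a word.\<close>

lemma cyclic_residue_code_poly:
  assumes "n > 0"
  obtains c where "c \<in> carrier_vec n" "cyclic_residue n (code_poly c) = cyclic_residue n (p :: 'k::field poly)"
proof -
  let ?m = "Polynomial.monom 1 n - 1 :: 'k poly"
  have m: "?m \<noteq> 0" using assms by (simp add: monom_eq_1_iff)
  have "degree ?m \<le> n" by (rule degree_diff_le) (auto simp: degree_monom_eq)
  then have "degree (p mod ?m) < n" using degree_mod_less[OF m, of p] assms by auto
  then obtain c where "c \<in> carrier_vec n" "code_poly c = p mod ?m"
    using bij_betw_code_poly[OF assms, where 'k = 'k] unfolding bij_betw_def by (metis (mono_tags, lifting) imageE mem_Collect_eq)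
  moreover have "?m dvd p mod ?m - p" by (metis dvd_minus_mod dvd_minus_iff minus_diff_eq)
  ultimately show ?thesis using that by (simp add: cyclic_residue_eq_iff)
qed

lemma image_code_generated_by:
  assumes "n > 0"
  shows "(\<lambda>c. cyclic_residue n (code_poly c)) ` code_generated_by n g
    = PIdl\<^bsub>cyclic_ring n\<^esub> (cyclic_residue n (g :: 'k::field poly))"
proof
  show "PIdl\<^bsub>cyclic_ring n\<^esub> (cyclic_residue n g)
      \<subseteq> (\<lambda>c. cyclic_residue n (code_poly c)) ` code_generated_by n g"
  proof
    fix r assume r: "r \<in> PIdl\<^bsub>cyclic_ring n\<^esub> (cyclic_residue n g)"
    then obtain f where "r = cyclic_residue n (f * g)" unfolding PIdl_cyclic_ring by auto
    moreover obtain c where "c \<in> carrier_vec n" "cyclic_residue n (code_poly c) = cyclic_residue n (f * g)"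
      using cyclic_residue_code_poly[OF assms] .
    ultimately show "r \<in> (\<lambda>c. cyclic_residue n (code_poly c)) ` code_generated_by n g"
      using r by (auto simp: code_generated_by_def intro!: image_eqI[of _ _ c])
  qed
qed (auto simp: code_generated_by_def)

lemma cyclic_code_generated_by:
  assumes "n > 0"
  shows "cyclic_code n (code_generated_by n (g :: 'k::field poly))"
  unfolding cyclic_code_def image_code_generated_by[OF assms]
  by (auto simp: code_generated_by_def carrier_cyclic_ring intro!: cring.cgenideal_ideal[OF cyclic_ring])

text \<open>As \<open>g\<close> divides the modulus, divisibility by \<open>g\<close> does not
  depend on the representative of a residue.\<close>

lemma cyclic_residue_mem_PIdl_iff:
  assumes "g dvd Polynomial.monom 1 n - 1"
  shows "cyclic_residue n p \<in> PIdl\<^bsub>cyclic_ring n\<^esub> (cyclic_residue n g) \<longleftrightarrow> g dvd (p :: 'k::field poly)"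
proof
  assume "cyclic_residue n p \<in> PIdl\<^bsub>cyclic_ring n\<^esub> (cyclic_residue n g)"
  then obtain f where "Polynomial.monom 1 n - 1 dvd p - f * g"
    unfolding PIdl_cyclic_ring by (auto simp: cyclic_residue_eq_iff)
  then have "g dvd (p - f * g) + f * g" using assms by (intro dvd_add) (auto intro: dvd_trans)
  then show "g dvd p" by simp
next
  assume "g dvd p"
  then obtain f where "p = g * f" by (rule dvdE)
  then show "cyclic_residue n p \<in> PIdl\<^bsub>cyclic_ring n\<^esub> (cyclic_residue n g)"
    unfolding PIdl_cyclic_ring by (intro range_eqI[of _ _ f]) (simp add: mult.commute)
qed

lemma code_generated_by_eq:
  assumes "g dvd Polynomial.monom 1 n - 1"
  shows "code_generated_by n g = {c \<in> carrier_vec n. (g :: 'k::field poly) dvd code_poly c}"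
  unfolding code_generated_by_def cyclic_residue_mem_PIdl_iff[OF assms] by simp

text \<open>Any other generator \<open>h\<close> lies in the ideal of \<open>g\<close>, so
  \<open>g\<close> divides it.\<close>

lemma generator_polynomial_code_generated_by:
  assumes "n > 0" and monic: "lead_coeff g = 1" and dvd: "(g :: 'k::field poly) dvd Polynomial.monom 1 n - 1"
  shows "generator_polynomial n (code_generated_by n g) g"
  unfolding generator_polynomial_def generates_code_def image_code_generated_by[OF assms(1)]
proof (intro conjI allI impI)
  fix h :: "'k poly"
  assume h: "lead_coeff h = 1 \<and> PIdl\<^bsub>cyclic_ring n\<^esub> (cyclic_residue n g) = PIdl\<^bsub>cyclic_ring n\<^esub> (cyclic_residue n h)"
  have "cyclic_residue n h \<in> PIdl\<^bsub>cyclic_ring n\<^esub> (cyclic_residue n h)"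
    unfolding PIdl_cyclic_ring by (rule range_eqI[of _ _ 1]) simp
  then have "g dvd h" using h cyclic_residue_mem_PIdl_iff[OF dvd] by simp
  moreover have "h \<noteq> 0" using h by auto
  ultimately show "degree g \<le> degree h" by (rule dvd_imp_degree_le)
qed (use monic in auto)

end

text \<open>Words correspond to the multiples \<open>g * f\<close>, where \<open>f\<close> ranges
  over the polynomials of degree below \<open>n - degree g\<close>.\<close>

lemma card_code_generated_by:
  assumes g: "(g :: 'k::{field,finite} poly) dvd Polynomial.monom 1 n - 1" and deg: "degree g < n"
  shows "card (code_generated_by n g) = CARD('k) ^ (n - degree g)"
proof -
  have n: "n > 0" using deg by simp
  then have "Polynomial.monom 1 n - 1 \<noteq> (0 :: 'k poly)" by (simp add: monom_eq_1_iff)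
  then have "g \<noteq> 0" using g by auto
  have "code_poly ` code_generated_by n g = {p. degree p < n} \<inter> {p. g dvd p}"
    using bij_betw_imp_surj_on[OF bij_betw_code_poly[OF n, where 'k = 'k]]
    unfolding code_generated_by_eq[OF g] by auto
  also have "\<dots> = (\<lambda>f. g * f) ` {f. degree f < n - degree g}"
  proof (intro equalityI subsetI)
    fix p assume p: "p \<in> {p. degree p < n} \<inter> {p. g dvd p}"
    then have "g dvd p" by simp
    then obtain f where f: "p = g * f" by (rule dvdE)
    \<comment> \<open>For \<open>f = 0\<close>, whose degree is 0, the bound rests on
      \<open>degree g < n\<close>.\<close>
    have "degree f < n - degree g"
      using p deg \<open>g \<noteq> 0\<close> unfolding f by (cases "f = 0") (auto simp: degree_mult_eq)
    then show "p \<in> (\<lambda>f. g * f) ` {f. degree f < n - degree g}" unfolding f by (intro imageI) simp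
  next
    fix p assume "p \<in> (\<lambda>f. g * f) ` {f. degree f < n - degree g}"
    then obtain f where f: "p = g * f" "degree f < n - degree g" by auto
    have "degree p < n" using f(2) degree_mult_le[of g f] unfolding f(1) by linarith
    then show "p \<in> {p. degree p < n} \<inter> {p. g dvd p}" unfolding f(1) by simp
  qed
  finally have "code_poly ` code_generated_by n g = (\<lambda>f. g * f) ` {f. degree f < n - degree g}" .
  moreover have "card (code_poly ` code_generated_by n g) = card (code_generated_by n g)"
    by (rule card_image, rule inj_on_subset[OF bij_betw_imp_inj_on[OF bij_betw_code_poly[OF n]]])
      (auto simp: code_generated_by_def)
  moreover have "card ((\<lambda>f. g * f) ` {f. degree f < n - degree g}) = CARD('k) ^ (n - degree g)"
    using deg \<open>g \<noteq> 0\<close> by (subst card_image) (auto simp: inj_on_def card_poly_degree_less)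
  ultimately show ?thesis by simp
qed

section \<open>Dimension and sphere packing\<close>

lemma linear_subspaceD:
  assumes "VectorSpace.subspace class_ring C (module_vec TYPE('k::field) n)"
  shows "C \<subseteq> carrier_vec n" "0\<^sub>v n \<in> C"
    and "u \<in> C \<Longrightarrow> v \<in> C \<Longrightarrow> u + v \<in> C" "u \<in> C \<Longrightarrow> a \<cdot>\<^sub>v u \<in> C"
    and "u \<in> C \<Longrightarrow> v \<in> C \<Longrightarrow> u - v \<in> C"
proof -
  interpret V: vec_space "TYPE('k)" n .
  have sub: "submodule class_ring C V.V" using assms by (rule V.is_module)
  show C: "C \<subseteq> carrier_vec n" "0\<^sub>v n \<in> C"
    and add: "u \<in> C \<Longrightarrow> v \<in> C \<Longrightarrow> u + v \<in> C" 
    and smult: "u \<in> C \<Longrightarrow> a \<cdot>\<^sub>v u \<in> C" for u v a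
    using sub submodule.subset[OF sub] submodule.zero_closed[OF sub] submodule.m_closed[OF sub]
      submodule.smult_closed[OF sub] by (simp_all add: module_vec_simps)
  show "u - v \<in> C" if "u \<in> C" "v \<in> C"
  proof -
    have "u - v = u + (- 1) \<cdot>\<^sub>v v" using that C by (intro eq_vecI) auto
    then show ?thesis using add[OF that(1) smult[OF that(2)]] by simp
  qed
qed

lemma linear_subspaceI:
  assumes "C \<subseteq> carrier_vec n" "0\<^sub>v n \<in> C"
    and "\<And>u v. u \<in> C \<Longrightarrow> v \<in> C \<Longrightarrow> u + v \<in> C" "\<And>a u. u \<in> C \<Longrightarrow> a \<cdot>\<^sub>v u \<in> C"
  shows "VectorSpace.subspace class_ring C (module_vec TYPE('k::field) n)"
proof -
  interpret V: vec_space "TYPE('k)" n .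
  have "submodule class_ring C V.V"
    by (rule submodule.intro[OF vec_module]) (use assms in \<open>simp_all add: module_vec_simps\<close>)
  then show ?thesis unfolding VectorSpace.subspace_def using V.vectorspace_axioms by simp
qed

text \<open>Coordinates in a basis are unique, so words correspond to functions from the basis to
  the field. Dimensions can then be read off by counting.\<close>

lemma card_linear_subspace:
  assumes "VectorSpace.subspace class_ring C (module_vec TYPE('k::{field,finite}) n)"
  shows "card C = CARD('k) ^ code_dim n C"
proof -
  interpret V: vec_space "TYPE('k)" n .
  interpret W: vectorspace class_ring "V.V\<lparr>carrier := C\<rparr>"
    by (rule V.subspace_is_vs[OF assms])
  have "finite C" using linear_subspaceD(1)[OF assms] finite_carrier_vec by (rule finite_subset)
  moreover have "W.span C \<subseteq> C" using W.span_is_subset2[of C] by simp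
  moreover have "C \<subseteq> W.span C" using W.in_own_span[of C] by simp
  ultimately have "W.fin_dim" unfolding W.fin_dim_def by (intro exI[of _ C]) auto
  then obtain B where B: "finite B" "W.basis B" using W.finite_basis_exists by blast
  have "B \<subseteq> C" using B(2) by (simp add: W.basis_def)
  then have ex1: "\<And>v. v \<in> C \<Longrightarrow> \<exists>!a. a \<in> B \<rightarrow>\<^sub>E UNIV \<and> W.lincomb a B = v"
    using W.basis_criterion[OF B(1)] B(2) by simp
  have "bij_betw (\<lambda>a. W.lincomb a B) (B \<rightarrow>\<^sub>E (UNIV :: 'k set)) C"
    unfolding bij_betw_def
  proof
    have cl: "W.lincomb a B \<in> C" for a using W.lincomb_closed[of B a] \<open>B \<subseteq> C\<close> by simp
    show "inj_on (\<lambda>a. W.lincomb a B) (B \<rightarrow>\<^sub>E UNIV)" using ex1 cl by (intro inj_onI) metis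
    show "(\<lambda>a. W.lincomb a B) ` (B \<rightarrow>\<^sub>E UNIV) = C" using ex1 cl by (intro equalityI subsetI) (blast, metis imageI)
  qed
  then have "card C = card (B \<rightarrow>\<^sub>E (UNIV :: 'k set))" by (rule bij_betw_same_card[symmetric])
  also have "\<dots> = CARD('k) ^ card B" using B(1) by (simp add: card_PiE)
  also have "card B = code_dim n C" unfolding code_dim_def using W.dim_basis[OF B] by simp
  finally show ?thesis .
qed

lemma subspace_code_generated_by:
  assumes g: "(g :: 'k::field poly) dvd Polynomial.monom 1 n - 1"
  shows "VectorSpace.subspace class_ring (code_generated_by n g) (module_vec TYPE('k) n)"
proof -
  have add: "code_poly (u + v) = code_poly u + code_poly v" if "u \<in> carrier_vec n" "v \<in> carrier_vec n" for u v :: "'k vec"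
    using that by (intro poly_eqI) (simp add: coeff_code_poly)
  have smult: "code_poly (a \<cdot>\<^sub>v u) = Polynomial.smult a (code_poly u)" if "u \<in> carrier_vec n" for a and u :: "'k vec"
    using that by (intro poly_eqI) (simp add: coeff_code_poly)
  have zero: "code_poly (0\<^sub>v n :: 'k vec) = 0" by (intro poly_eqI) (simp add: coeff_code_poly)
  show ?thesis unfolding code_generated_by_eq[OF g]
    by (rule linear_subspaceI) (auto simp: add smult zero dvd_smult)
qed

lemma min_dist_le:
  assumes "u \<in> C" "v \<in> C" "u \<noteq> v"
  shows "min_dist C \<le> hamming_dist u v"
  unfolding min_dist_def by (rule cInf_lower) (use assms in auto)

lemma hamming_dist_le:
  assumes "\<And>i. i < dim_vec u \<Longrightarrow> i \<notin> S \<Longrightarrow> u $ i = v $ i" "finite S"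
  shows "hamming_dist u v \<le> card S"
  unfolding hamming_dist_def using assms by (intro card_mono) auto

text \<open>Sphere packing, using only the error patterns of weight exactly 2.\<close>

lemma card_code_min_dist_5:
  fixes C :: "'k::{field,finite} vec set"
  assumes C: "C \<subseteq> carrier_vec n" and dist: "min_dist C \<ge> 5"
  shows "card C * ((n choose 2) * (CARD('k) - 1)\<^sup>2) \<le> CARD('k) ^ n"
proof -
  define err :: "(nat \<times> nat) \<times> ('k \<times> 'k) \<Rightarrow> 'k vec"
    where "err = (\<lambda>((j, i), (a, b)). vec n (\<lambda>l. if l = j then a else if l = i then b else 0))"
  \<comment> \<open>Ordering the two positions makes each error pattern arise only once.\<close>
  define P where "P = (SIGMA j:{..<n}. {..<j}) \<times> ((UNIV - {0 :: 'k}) \<times> (UNIV - {0 :: 'k}))"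
  have err_dim: "err p \<in> carrier_vec n" for p by (auto simp: err_def split: prod.splits)
  have err_0: "err p $ l = 0" if "l < n" "l \<noteq> fst (fst p)" "l \<noteq> snd (fst p)" for p l
    using that by (auto simp: err_def split: prod.splits)
  have err_inj: "inj_on err P"
  proof (rule inj_onI)
    fix p p' assume p: "p \<in> P" "p' \<in> P" and eq: "err p = err p'"
    obtain j i a b where p_eq: "p = ((j, i), (a, b))" by (metis prod.collapse)
    obtain j' i' a' b' where p'_eq: "p' = ((j', i'), (a', b'))" by (metis prod.collapse)
    have *: "i < j" "j < n" "a \<noteq> 0" "b \<noteq> 0" "i' < j'" "j' < n" "a' \<noteq> 0" "b' \<noteq> 0"
      using p by (auto simp: P_def p_eq p'_eq)
    have eq': "(if l = j then a else if l = i then b else 0) = (if l = j' then a' else if l = i' then b' else 0)"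
      if "l < n" for l
      using arg_cong[OF eq, of "\<lambda>v. v $ l"] that by (simp add: err_def p_eq p'_eq)
    have "j = j' \<or> j = i'" using eq'[of j] * by (auto split: if_splits)
    moreover have "j' = j \<or> j' = i" using eq'[of j'] * by (auto split: if_splits)
    moreover have "i = j' \<or> i = i'" using eq'[of i] * by (auto split: if_splits)
    ultimately have ij: "j = j'" "i = i'" using * by auto
    then show "p = p'" using eq'[of j] eq'[of i] * by (auto simp: p_eq p'_eq)
  qed
  have "inj_on (\<lambda>(c, p). c + err p) (C \<times> P)"
  proof (rule inj_onI, clarify)
    fix c p c' p'
    assume c: "c \<in> C" "c' \<in> C" and p: "p \<in> P" "p' \<in> P" and eq: "c + err p = c' + err p'"
    have dim: "dim_vec c = n" "dim_vec c' = n" "dim_vec (err p) = n" "dim_vec (err p') = n"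
      using c C err_dim by auto
    have eq': "c $ l + err p $ l = c' $ l + err p' $ l" if "l < n" for l
      using arg_cong[OF eq, of "\<lambda>v. v $ l"] that dim by simp
    \<comment> \<open>Away from the at most four error positions both errors vanish, so
      \<open>c\<close> and \<open>c'\<close> agree there.\<close>
    have "hamming_dist c c' \<le> card {fst (fst p), snd (fst p), fst (fst p'), snd (fst p')}"
      using eq' err_0 dim by (intro hamming_dist_le) (simp_all, metis add.right_neutral)
    also have "\<dots> \<le> 4" by (rule card_insert_le_m1 | simp)+
    finally have "c = c'" using min_dist_le[OF c] dist by linarith
    moreover have "err p = err p'"
      using eq' dim unfolding \<open>c = c'\<close> by (intro eq_vecI) simp_all
    then have "p = p'" using err_inj p by (simp add: inj_on_eq_iff)
    ultimately show "c = c' \<and> p = p'" by simp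
  qed
  moreover have "(\<lambda>(c, p). c + err p) ` (C \<times> P) \<subseteq> carrier_vec n"
    using C err_dim by auto
  ultimately have "card (C \<times> P) \<le> card (carrier_vec n :: 'k vec set)"
    by (rule card_inj_on_le) simp
  moreover have "card P = (n choose 2) * (CARD('k) - 1)\<^sup>2"
  proof -
    have "card (SIGMA j:{..<n}. {..<j}) = (n choose 2)"
      by (simp add: lessThan_atLeast0 Sum_Ico_nat choose_two)
    then show ?thesis by (simp add: P_def card_cartesian_product card_Diff_singleton power2_eq_square)
  qed
  ultimately show ?thesis by (simp add: card_cartesian_product card_carrier_vec)
qed

section \<open>The optimal code\<close>

context ternary_extension
begin

text \<open>With three elements \<open>a ^ 3 = a\<close>, so a nonzero \<open>a\<close> squares to
  1. The nonzero entries of a word thus act as signs.\<close>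

lemma nonzero_image_sign:
  assumes "a \<noteq> 0"
  shows "\<iota> a = 1 \<or> \<iota> a = - 1"
proof -
  have "a * a\<^sup>2 = a * 1" using power_3_power[of a 1] by (simp add: power2_eq_square power3_eq_cube mult.assoc)
  then have "a\<^sup>2 = 1" by (rule mult_left_cancel[OF assms, THEN iffD1])
  then have "a = 1 \<or> a = - 1" by (rule power2_eq_1_iff[THEN iffD1])
  then show ?thesis by (auto simp: hom_distribs)
qed

lemma poly_code_poly:
  "poly (map_poly \<iota> (code_poly c)) x = (\<Sum>i\<in>{i. i < dim_vec c \<and> c $ i \<noteq> 0}. \<iota> (c $ i) * x ^ i)"
proof -
  have "poly (map_poly \<iota> (code_poly c)) x = (\<Sum>i<dim_vec c. \<iota> (c $ i) * x ^ i)"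
    unfolding code_poly_def by (simp add: hom_distribs poly_sum poly_monom)
  also have "\<dots> = (\<Sum>i\<in>{i. i < dim_vec c \<and> c $ i \<noteq> 0}. \<iota> (c $ i) * x ^ i)"
    by (rule sum.mono_neutral_right) auto
  finally show ?thesis .
qed

end

section \<open>Powers of the generator and the degrees of the three minimal polynomials\<close>

locale ternary_code = ternary_extension \<iota>
  for \<iota> :: "'k::{field,finite} \<Rightarrow> 'a::{field,finite}" +
  fixes \<alpha> :: 'a and h n E :: nat
  assumes h: "h > 0" and card_a: "CARD('a) = 9 ^ h" and gen: "mult_generator \<alpha>"
    and n: "n = 9 ^ h - 1" and E: "E + (3 ^ h + 1) = half_order h"
begin

lemma \<alpha>_nonzero: "\<alpha> \<noteq> 0"
proof
  assume "\<alpha> = 0"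
  then have "\<alpha> powi 1 \<notin> range (\<lambda>j::int. \<alpha> powi j)" using gen unfolding mult_generator_def by simp
  then show False by blast
qed

lemma n_eq: "n = (3 ^ h + 1) * (3 ^ h - 1)"
proof -
  have "(9::nat) ^ h = 3 ^ h * 3 ^ h" by (simp flip: power_mult_distrib)
  then show ?thesis by (simp add: n algebra_simps)
qed

lemma n_ge: "n \<ge> 8 * h"
proof -
  have "8 * k + 1 \<le> (9::nat) ^ k" for k by (induction k) auto
  from this[of h] show ?thesis unfolding n by linarith
qed

lemma n_pos: "n > 0" using n_ge h by linarith

lemma n_half: "n = 2 * half_order h" by (simp add: n half_order_double)

lemma power_n: "x \<noteq> 0 \<Longrightarrow> (x :: 'a) ^ n = 1"
  using finite_field_power_card_minus_one[of x] by (simp add: card_a n)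

text \<open>Integer exponents reduce modulo \<open>n\<close>, so the first \<open>n\<close> powers
  cover all \<open>n\<close> nonzero elements and must be distinct.\<close>

lemma inj_powers: "inj_on (\<lambda>i. \<alpha> ^ i) {..<n}"
proof (rule eq_card_imp_inj_on)
  have "UNIV - {0} \<subseteq> (\<lambda>i. \<alpha> ^ i) ` {..<n}"
  proof
    fix x :: 'a assume "x \<in> UNIV - {0}"
    then obtain j :: int where x: "x = \<alpha> powi j" using gen unfolding mult_generator_def by blast
    have "j = int n * (j div int n) + int (nat (j mod int n))" using n_pos by simp
    then have "x = (\<alpha> powi int n) powi (j div int n) * \<alpha> powi int (nat (j mod int n))"
      unfolding x using \<alpha>_nonzero by (metis power_int_add power_int_mult)
    also have "\<alpha> powi int n = 1" using power_n[OF \<alpha>_nonzero] by simp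
    finally have "x = \<alpha> ^ nat (j mod int n)"
      by (simp only: power_int_1_left mult_1_left power_int_of_nat)
    moreover have "nat (j mod int n) < n" using n_pos by (simp add: nat_less_iff)
    ultimately show "x \<in> (\<lambda>i. \<alpha> ^ i) ` {..<n}" by blast
  qed
  moreover have "(\<lambda>i. \<alpha> ^ i) ` {..<n} \<subseteq> UNIV - {0}" using \<alpha>_nonzero by auto
  ultimately have "(\<lambda>i. \<alpha> ^ i) ` {..<n} = UNIV - {0}" by (rule equalityI[rotated])
  then show "card ((\<lambda>i. \<alpha> ^ i) ` {..<n}) = card {..<n}"
    by (simp add: card_Diff_singleton card_a n)
qed simp

lemma power_eq_iff: "i < n \<Longrightarrow> j < n \<Longrightarrow> \<alpha> ^ i = \<alpha> ^ j \<longleftrightarrow> i = j"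
  using inj_powers by (simp add: inj_on_eq_iff)

text \<open>The value is a sign, and it is not 1 because the exponent lies strictly between 0 and
  \<open>n\<close>.\<close>

lemma power_half_order: "\<alpha> ^ half_order h = - 1"
proof -
  have "0 < half_order h" "half_order h < n" using n_half n_pos by auto
  then have "\<alpha> ^ half_order h \<noteq> \<alpha> ^ 0" by (subst power_eq_iff) auto
  then show ?thesis using half_order_power[OF h card_a E \<alpha>_nonzero] by simp
qed

lemma power_E_mult: "\<alpha> ^ E * \<alpha> ^ (3 ^ h + 1) = - 1"
  using power_E[OF h card_a E, of \<alpha>] by (simp only: power_half_order)

text \<open>The power by \<open>3 ^ (2 * h)\<close> fixes \<open>\<alpha>\<close>, and the lower
  exponents \<open>3 ^ k\<close> stay below \<open>n\<close>, so they give distinct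
  conjugates.\<close>

lemma degree_minimal_poly_generator: "degree (minimal_poly \<iota> \<alpha>) = 2 * h"
proof (rule antisym)
  have "(3::nat) ^ (2 * h) = 9 ^ h" by (simp add: power_mult)
  then show "degree (minimal_poly \<iota> \<alpha>) \<le> 2 * h"
    using h finite_field_power_card[of \<alpha>] by (intro degree_minimal_poly_le) (simp_all add: card_a)
  show "2 * h \<le> degree (minimal_poly \<iota> \<alpha>)"
  proof (rule degree_minimal_poly_ge, rule inj_onI)
    fix i j assume ij: "i \<in> {..<2 * h}" "j \<in> {..<2 * h}" and eq: "\<alpha> ^ 3 ^ i = \<alpha> ^ 3 ^ j"
    have lt: "3 ^ k < n" if "k \<in> {..<2 * h}" for k
    proof -
      have "(3::nat) ^ Suc k \<le> 3 ^ (2 * h)" using that by (intro power_increasing) auto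
      moreover have "(3::nat) ^ k \<ge> 1" by simp
      ultimately show ?thesis using \<open>(3::nat) ^ (2 * h) = 9 ^ h\<close> unfolding n power_Suc by linarith
    qed
    have "(3::nat) ^ i = 3 ^ j" using eq power_eq_iff[OF lt lt] ij by simp
    then show "i = j" by simp
  qed
qed

text \<open>\<open>\<alpha> ^ E\<close> is minus the inverse of the norm \<open>N\<close> of
  \<open>\<alpha>\<close>. The norm lies in the subfield with \<open>3 ^ h\<close> elements, and its
  first \<open>h\<close> conjugates are distinct.\<close>

lemma degree_minimal_poly_E: "degree (minimal_poly \<iota> (\<alpha> ^ E)) = h"
proof (rule antisym)
  define N where "N = \<alpha> ^ (3 ^ h + 1)"
  have N0: "N \<noteq> 0" using \<alpha>_nonzero by (simp add: N_def)
  have EN: "(\<alpha> ^ E) ^ (3 ^ j) = - inverse (N ^ (3 ^ j))" for j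
  proof -
    have "(\<alpha> ^ E * N) ^ (3 ^ j) = - 1" unfolding N_def power_E_mult by simp
    then have "(\<alpha> ^ E) ^ (3 ^ j) * N ^ (3 ^ j) = - 1" by (simp only: power_mult_distrib)
    then show ?thesis using N0 by (simp add: field_simps)
  qed
  have "N ^ (3 ^ h) = \<alpha> ^ ((3 ^ h + 1) * 3 ^ h)" by (simp only: N_def power_mult)
  also have "(3 ^ h + 1) * 3 ^ h = 3 ^ h * 3 ^ h + (3::nat) ^ h" by simp
  also have "(3::nat) ^ h * 3 ^ h = 9 ^ h" by (simp flip: power_mult_distrib)
  also have "\<alpha> ^ (9 ^ h + 3 ^ h) = N"
    using finite_field_power_card[of \<alpha>] by (simp add: power_add N_def card_a)
  finally have "N ^ (3 ^ h) = N" .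
  then have "(\<alpha> ^ E) ^ (3 ^ h) = \<alpha> ^ E" using EN[of h] EN[of 0] by simp
  then show "degree (minimal_poly \<iota> (\<alpha> ^ E)) \<le> h" using h by (rule degree_minimal_poly_le)
  show "h \<le> degree (minimal_poly \<iota> (\<alpha> ^ E))"
  proof (rule degree_minimal_poly_ge, rule inj_onI)
    fix i j assume ij: "i \<in> {..<h}" "j \<in> {..<h}" and eq: "(\<alpha> ^ E) ^ 3 ^ i = (\<alpha> ^ E) ^ 3 ^ j"
    \<comment> \<open>Factoring \<open>n\<close> leaves \<open>3 ^ k < 3 ^ h - 1\<close>, which
      holds because \<open>3 * 3 ^ k \<le> 3 ^ h\<close>.\<close>
    have lt: "(3 ^ h + 1) * 3 ^ k < n" if "k \<in> {..<h}" for k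
    proof -
      have "(3::nat) ^ Suc k \<le> 3 ^ h" using that by (intro power_increasing) auto
      moreover have "(3::nat) ^ k \<ge> 1" by simp
      ultimately have "(3::nat) ^ k < 3 ^ h - 1" unfolding power_Suc by linarith
      then show ?thesis unfolding n_eq by (intro mult_strict_left_mono) auto
    qed
    have "N ^ 3 ^ i = N ^ 3 ^ j" using eq unfolding EN by simp
    then have "\<alpha> ^ ((3 ^ h + 1) * 3 ^ i) = \<alpha> ^ ((3 ^ h + 1) * 3 ^ j)" unfolding N_def power_mult .
    then have "(3 ^ h + 1) * (3::nat) ^ i = (3 ^ h + 1) * 3 ^ j" using power_eq_iff[OF lt lt] ij by blast
    then show "i = j" by (simp only: mult_cancel1) simp
  qed
qed

lemma minimal_poly_half_order_dvd: "minimal_poly \<iota> (\<alpha> ^ half_order h) dvd [:1, 1:]"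
  unfolding minimal_poly_dvd_iff power_half_order by (simp add: Polynomial.map_poly_pCons)

lemma degree_minimal_poly_half_order: "degree (minimal_poly \<iota> (\<alpha> ^ half_order h)) = 1"
proof (rule antisym)
  show "degree (minimal_poly \<iota> (\<alpha> ^ half_order h)) \<le> 1"
    using dvd_imp_degree_le[OF minimal_poly_half_order_dvd] by simp
  show "1 \<le> degree (minimal_poly \<iota> (\<alpha> ^ half_order h))"
    by (rule degree_minimal_poly_ge) (simp add: inj_on_def)
qed

text \<open>The bracketing follows the list product in \<open>exponent_poly\<close>.\<close>

definition g :: "'k poly" where
  "g = minimal_poly \<iota> \<alpha> * (minimal_poly \<iota> (\<alpha> ^ E) * minimal_poly \<iota> (\<alpha> ^ half_order h))"

lemma monic_g: "lead_coeff g = 1"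
  unfolding g_def lead_coeff_mult minimal_poly_monic by simp

lemma degree_g: "degree g = 3 * h + 1"
  unfolding g_def
  by (simp add: degree_mult_eq minimal_poly_nonzero degree_minimal_poly_generator
      degree_minimal_poly_E degree_minimal_poly_half_order)

lemma degree_g_less: "degree g < n" using n_ge h unfolding degree_g by linarith

text \<open>Each factor divides \<open>x ^ n - 1\<close>, and the product does because no factor
  vanishes at the element defining an earlier one. For \<open>\<alpha> ^ E\<close> this means
  \<open>\<alpha> ^ E \<noteq> - 1\<close>; for \<open>\<alpha>\<close> it follows from the
  degrees.\<close>

lemma g_dvd: "g dvd Polynomial.monom 1 n - 1"
proof -
  have dvd: "minimal_poly \<iota> (\<alpha> ^ i) dvd Polynomial.monom 1 n - 1" for i
    unfolding minimal_poly_dvd_iff using power_n[of "\<alpha> ^ i"] \<alpha>_nonzero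
    by (simp add: hom_distribs poly_monom)
  have E_half: "E < half_order h" using E by linarith
  have "poly (map_poly \<iota> (minimal_poly \<iota> (\<alpha> ^ half_order h))) (\<alpha> ^ E) \<noteq> 0"
  proof
    assume "poly (map_poly \<iota> (minimal_poly \<iota> (\<alpha> ^ half_order h))) (\<alpha> ^ E) = 0"
    then have "minimal_poly \<iota> (\<alpha> ^ E) dvd [:1, 1:]"
      using minimal_poly_half_order_dvd dvd_trans unfolding minimal_poly_dvd_iff[symmetric] by blast
    then have "1 + \<alpha> ^ E = 0" unfolding minimal_poly_dvd_iff by (simp add: Polynomial.map_poly_pCons)
    then have "\<alpha> ^ E = \<alpha> ^ half_order h" unfolding power_half_order by (simp add: add_eq_0_iff)
    then show False using E_half n_half by (simp add: power_eq_iff)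
  qed
  then have "minimal_poly \<iota> (\<alpha> ^ E) * minimal_poly \<iota> (\<alpha> ^ half_order h) dvd Polynomial.monom 1 n - 1"
    by (rule minimal_poly_mult_dvd[OF dvd dvd])
  moreover have "poly (map_poly \<iota> (minimal_poly \<iota> \<beta>)) \<alpha> \<noteq> 0"
    if "degree (minimal_poly \<iota> \<beta>) < 2 * h" for \<beta>
  proof
    assume "poly (map_poly \<iota> (minimal_poly \<iota> \<beta>)) \<alpha> = 0"
    then have "degree (minimal_poly \<iota> \<alpha>) \<le> degree (minimal_poly \<iota> \<beta>)"
      unfolding minimal_poly_dvd_iff[symmetric] using minimal_poly_nonzero by (rule dvd_imp_degree_le)
    then show False using that by (simp add: degree_minimal_poly_generator)
  qed
  then have "poly (map_poly \<iota> (minimal_poly \<iota> (\<alpha> ^ E) * minimal_poly \<iota> (\<alpha> ^ half_order h))) \<alpha> \<noteq> 0"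
    using h by (simp add: hom_distribs degree_minimal_poly_E degree_minimal_poly_half_order)
  ultimately show ?thesis unfolding g_def using dvd[of 1] minimal_poly_mult_dvd[of \<alpha>] by simp
qed

section \<open>Minimum distance and optimality\<close>

lemma g_dvd_imp_roots:
  assumes "g dvd p"
  shows "poly (map_poly \<iota> p) \<alpha> = 0" "poly (map_poly \<iota> p) (\<alpha> ^ E) = 0"
    "poly (map_poly \<iota> p) (\<alpha> ^ half_order h) = 0"
  unfolding minimal_poly_dvd_iff[symmetric]
  by (rule dvd_trans[OF _ assms], simp add: g_def)+

text \<open>The three roots of \<open>g\<close> give signed power sums over the support. One term
  cannot vanish, and two or three are handled by \<open>weight_two\<close> and
  \<open>weight_three\<close> at the locators \<open>\<alpha> ^ i\<close>.\<close>

lemma weight_ge_4: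
  assumes c: "c \<in> code_generated_by n g" "c \<noteq> 0\<^sub>v n"
  shows "card {i. i < n \<and> c $ i \<noteq> 0} \<ge> 4"
proof (rule ccontr)
  define S where "S = {i. i < n \<and> c $ i \<noteq> 0}"
  assume "\<not> 4 \<le> card {i. i < n \<and> c $ i \<noteq> 0}"
  then have "card S < 4" by (simp add: S_def)
  then have card: "card S = 0 \<or> card S = 1 \<or> card S = 2 \<or> card S = 3" by linarith
  have dim: "dim_vec c = n" and "g dvd code_poly c"
    using c(1) unfolding code_generated_by_eq[OF g_dvd] by auto
  have ev: "(\<Sum>i\<in>S. \<iota> (c $ i) * (\<alpha> ^ i) ^ k) = poly (map_poly \<iota> (code_poly c)) (\<alpha> ^ k)" for k
    unfolding poly_code_poly dim S_def by (simp add: mult.commute flip: power_mult)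
  note roots = g_dvd_imp_roots[OF \<open>g dvd code_poly c\<close>]
  have sums: "(\<Sum>i\<in>S. \<iota> (c $ i) * \<alpha> ^ i) = 0" "(\<Sum>i\<in>S. \<iota> (c $ i) * (\<alpha> ^ i) ^ E) = 0"
    "(\<Sum>i\<in>S. \<iota> (c $ i) * (\<alpha> ^ i) ^ half_order h) = 0"
    using ev[of 1] ev[of E] ev[of "half_order h"] roots by simp_all
  have sign: "\<iota> (c $ i) = 1 \<or> \<iota> (c $ i) = - 1" if "i \<in> S" for i
    using that by (intro nonzero_image_sign) (simp add: S_def)
  have nz: "\<alpha> ^ i \<noteq> 0" for i using \<alpha>_nonzero by simp
  have dist: "\<alpha> ^ i \<noteq> \<alpha> ^ j" if "i \<in> S" "j \<in> S" "i \<noteq> j" for i j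
    using that power_eq_iff[of i j] by (simp add: S_def)
  consider "S = {}" | i where "S = {i}" | i j where "S = {i, j}" "i \<noteq> j"
    | i j k where "S = {i, j, k}" "i \<noteq> j" "i \<noteq> k" "j \<noteq> k"
  proof -
    have "finite S" by (simp add: S_def)
    then show ?thesis using card that
      by (metis card_0_eq card_1_singletonE card_2_iff card_3_iff)
  qed
  then show False
  proof cases
    case 1
    then have "c $ i = 0" if "i < n" for i using that by (auto simp: S_def)
    then have "c = 0\<^sub>v n" using dim by (intro eq_vecI) simp_all
    then show False using c(2) by simp
  next
    case (2 i)
    then show False using sums(1) sign[of i] nz[of i] by auto
  next
    case (3 i j)
    show False
      by (rule weight_two[OF h card_a E nz[of i] nz[of j] _ sign[of i] sign[of j]])
        (use 3 dist[of i j] sums in auto)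
  next
    case (4 i j k)
    show False
      by (rule weight_three[OF h card_a E nz[of i] nz[of j] nz[of k] _ _ _ sign[of i] sign[of j] sign[of k]])
        (use 4 dist[of i j] dist[of i k] dist[of j k] sums in \<open>auto simp: add.assoc\<close>)
  qed
qed

text \<open>With \<open>x = 3 ^ h\<close> and \<open>n = x ^ 2 - 1\<close>, packing would give
  \<open>2 * n * (n - 1) \<le> 3 * x ^ 3\<close>, where the left side is of order
  \<open>2 * x ^ 4\<close>. Optimality needs this for every code of the dimension.\<close>

lemma min_dist_less_5:
  assumes C: "VectorSpace.subspace class_ring C (module_vec TYPE('k) n)"
    and dim: "code_dim n C = n - (3 * h + 1)"
  shows "min_dist C < 5"
proof (rule ccontr)
  assume "\<not> min_dist C < 5"
  then have "card C * ((n choose 2) * (CARD('k) - 1)\<^sup>2) \<le> CARD('k) ^ n"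
    by (intro card_code_min_dist_5 linear_subspaceD(1)[OF C]) simp
  then have "3 ^ (n - (3 * h + 1)) * ((n choose 2) * 4) \<le> (3::nat) ^ n"
    by (simp add: card_linear_subspace[OF C] dim card_k)
  also have "(3::nat) ^ n = 3 ^ (n - (3 * h + 1)) * 3 ^ (3 * h + 1)"
    unfolding power_add[symmetric] using degree_g_less by (simp add: degree_g)
  finally have "(n choose 2) * 4 \<le> 3 ^ (3 * h + 1)" by simp
  moreover have "even (n * (n - 1))" by (cases n) simp_all
  then have "(n choose 2) * 2 = n * (n - 1)" unfolding choose_two by (rule dvd_div_mult_self)
  ultimately have le: "2 * (n * (n - 1)) \<le> 3 ^ (3 * h + 1)" by simp
  define x where "x = (3::int) ^ h"
  have x: "x \<ge> 3" unfolding x_def using power_increasing[of 1 h "3::int"] h by simp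
  have "int n = x\<^sup>2 - 1"
    by (simp add: n x_def of_nat_diff flip: power_mult power_mult_distrib) (simp add: power_mult mult.commute[of h])
  moreover have "int (n - 1) = int n - 1" using n_pos by simp
  moreover have "int (3 ^ (3 * h + 1)) = 3 * x ^ 3" by (simp add: x_def mult.commute[of 3] power_mult)
  moreover have "int (2 * (n * (n - 1))) \<le> int (3 ^ (3 * h + 1))" using le by (simp only: of_nat_le_iff)
  ultimately have "2 * ((x\<^sup>2 - 1) * (x\<^sup>2 - 2)) \<le> 3 * x ^ 3" by simp
  \<comment> \<open>These give \<open>3 * x ^ 3 \<le> x ^ 4\<close> and
    \<open>9 * x ^ 2 \<le> x ^ 4\<close>, which reduce the inequality to
    \<open>3 * x ^ 2 + 4 \<le> 0\<close>.\<close>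
  moreover have "x ^ 3 * 3 \<le> x ^ 3 * x" "x\<^sup>2 * 3 \<le> x\<^sup>2 * x" using x by (intro mult_left_mono; simp)+
  moreover have "x * x \<ge> 0" by simp
  ultimately show False by (simp add: algebra_simps power2_eq_square power3_eq_cube) 
qed

lemma linear_code_g: "linear_code n (n - (3 * h + 1)) 4 (code_generated_by n g)"
proof -
  let ?C = "code_generated_by n g"
  have sub: "VectorSpace.subspace class_ring ?C (module_vec TYPE('k) n)"
    by (rule subspace_code_generated_by[OF g_dvd])
  have card: "card ?C = 3 ^ (n - (3 * h + 1))"
    using card_code_generated_by[OF g_dvd degree_g_less] by (simp add: card_k degree_g)
  then have dim: "code_dim n ?C = n - (3 * h + 1)"
    using card_linear_subspace[OF sub] by (simp add: card_k)
  \<comment> \<open>Positive dimension yields two distinct words, so the set of distances is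
    nonempty and its \<open>Inf\<close> is not the default 0.\<close>
  have "n - (3 * h + 1) > 0" using degree_g_less by (simp add: degree_g)
  then have "card ?C \<noteq> 1" unfolding card by simp
  moreover have "0\<^sub>v n \<in> ?C" by (rule linear_subspaceD(2)[OF sub])
  ultimately obtain u v where uv: "u \<in> ?C" "v \<in> ?C" "u \<noteq> v"
    using is_singletonI'[of ?C] by (auto simp: is_singleton_altdef)
  have "min_dist ?C \<ge> 4" unfolding min_dist_def
  proof (rule cInf_greatest)
    show "{hamming_dist u v |u v. u \<in> ?C \<and> v \<in> ?C \<and> u \<noteq> v} \<noteq> {}" using uv by blast
    fix d assume "d \<in> {hamming_dist u v |u v. u \<in> ?C \<and> v \<in> ?C \<and> u \<noteq> v}"
    then obtain u v where d: "d = hamming_dist u v" and uv: "u \<in> ?C" "v \<in> ?C" "u \<noteq> v" by blast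
    have uv': "u \<in> carrier_vec n" "v \<in> carrier_vec n" using uv by (auto simp: code_generated_by_def)
    \<comment> \<open>By linearity the distance of \<open>u\<close> and \<open>v\<close> is the
      weight of a nonzero word.\<close>
    have "u - v \<in> ?C" using linear_subspaceD(5)[OF sub] uv by blast
    moreover have "u - v \<noteq> 0\<^sub>v n"
    proof
      assume eq: "u - v = 0\<^sub>v n"
      have "u $ i = v $ i" if "i < n" for i using arg_cong[OF eq, of "\<lambda>w. w $ i"] that uv' by simp
      then show False using uv(3) uv' by (metis carrier_vecD eq_vecI)
    qed
    ultimately have "card {i. i < n \<and> (u - v) $ i \<noteq> 0} \<ge> 4" by (rule weight_ge_4)
    also have "{i. i < n \<and> (u - v) $ i \<noteq> 0} = {i. i < dim_vec u \<and> u $ i \<noteq> v $ i}" using uv' by auto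
    finally show "4 \<le> d" unfolding d hamming_dist_def .
  qed
  then have "min_dist ?C = 4" using min_dist_less_5[OF sub dim] by simp
  then show ?thesis using sub dim by (simp add: linear_code_def)
qed

lemma optimal_code_g: "optimal_code n (n - (3 * h + 1)) 4 (code_generated_by n g)"
  using linear_code_g min_dist_less_5 unfolding optimal_code_def linear_code_def by fastforce

end

theorem corollary1:
  fixes m :: nat and e s :: int
    and \<iota> :: "'k::{field,finite} \<Rightarrow> 'a::{field,finite}"
    and \<alpha> :: 'a
    and C :: "'k vec set"
  assumes "m > 0" and "even m"
    and "CARD('k) = 3" and "CARD('a) = 3 ^ m"
    and "field_hom \<iota>"
    and "mult_generator \<alpha>"
    and "e = (3 ^ m - 1) div 2 - 3 ^ (m div 2) - 1"
    and "s = (3 ^ m - 1) div 2"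
    and "C = exponent_code \<iota> \<alpha> (3 ^ m - 1) [1, e, s]"
  shows "cyclic_code (3 ^ m - 1) C
    \<and> generator_polynomial (3 ^ m - 1) C (exponent_poly \<iota> \<alpha> [1, e, s])
    \<and> optimal_code (3 ^ m - 1) (3 ^ m - 3 * m div 2 - 2) 4 C"
proof -
  define h where "h = m div 2"
  define E where "E = half_order h - (3 ^ h + 1)"
  have m: "m = 2 * h" using assms(2) by (simp add: h_def)
  have h: "h > 0" using assms(1) m by simp
  have pow: "(3::nat) ^ m = 9 ^ h" "(3::int) ^ m = 9 ^ h" by (simp_all add: m power_mult)
  have E: "E + (3 ^ h + 1) = half_order h"
    using three_power_lt_half_order[OF h] by (simp add: E_def)
  interpret field_hom \<iota> by fact
  interpret ternary_code \<iota> \<alpha> h "3 ^ m - 1" E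
    by unfold_locales (use assms h E pow in simp_all)
  have "int (2 * half_order h) = 9 ^ h - 1" unfolding half_order_double by (simp add: of_nat_diff)
  then have s: "s = int (half_order h)" unfolding assms(8) pow by simp
  \<comment> \<open>Both exponents are nonnegative, so the integer powers in
    \<open>exponent_poly\<close> become natural ones.\<close>
  have e: "e = int E"
    unfolding assms(7) assms(8)[symmetric] s using arg_cong[OF E, of int] by (simp add: h_def)
  have g: "exponent_poly \<iota> \<alpha> [1, e, s] = g"
    unfolding exponent_poly_def e s by (simp add: g_def)
  \<comment> \<open>As \<open>m = 2 * h\<close>, the term \<open>3 * m div 2\<close> is
    \<open>3 * h\<close>, and both sides are the length minus the degree of
    \<open>g\<close>.\<close>
  have k: "3 ^ m - 3 * m div 2 - 2 = (3 ^ m - 1 :: nat) - (3 * h + 1)"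
    by (simp add: m)
  show ?thesis
    unfolding assms(9) exponent_code_def g k
    using cyclic_code_generated_by[OF n_pos] generator_polynomial_code_generated_by[OF n_pos monic_g g_dvd]
      optimal_code_g by simp
qed

end
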